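(* Let $n$ be a positive integer and let $\mathcal{F}=\{F_1,\ldots,F_m\}$ be a family of $m$ distinct subsets of $[n]=\{1,2,\ldots,n\}$. Suppose there exists a positive integer $\lambda>0$ such that $|F_i \,\Delta\, F_j|=\lambda$ for all $i\neq j$, where $\Delta$ denotes symmetric difference. Suppose further that $\lambda\neq \frac{n+1}{2}$. Then $m=|\mathcal{F}|\leq n$.
   Context: For sets $F,G\subseteq[n]$, the Hamming distance is $d_H(F,G)=|F\,\Delta\, G|$, the size of their symmetric difference. *)

theory Defs
  imports Complex_Main
begin

end

theory Submission
  imports Defs
begin

text \<open>Encode each set as its \<open>\<plusminus>1\<close> vector in \<open>\<real>\<^sup>n\<close>. Two distinct members of the family have inner
  product \<open>n - 2\<lambda>\<close>, so the Gram matrix is \<open>2\<lambda> I + (n - 2\<lambda>) J\<close>. If the family had \<open>n + 1\<close> members,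
  the vectors would be linearly dependent and this matrix singular, which forces
  \<open>2\<lambda> + (n + 1)(n - 2\<lambda>) = 0\<close>, that is, \<open>\<lambda> = (n + 1)/2\<close>.\<close>

text \<open>Gaussian elimination on a homogeneous system with more unknowns \<open>c i\<close> than
  equations: each induction step removes one equation and at most one unknown.\<close>

lemma nontrivial_linear_relation:
  fixes a :: "'i \<Rightarrow> 'j \<Rightarrow> 'k::field"
  assumes "finite J" "finite I" "card J < card I"
  shows "\<exists>c. (\<exists>i\<in>I. c i \<noteq> 0) \<and> (\<forall>j\<in>J. (\<Sum>i\<in>I. c i * a i j) = 0)"
  using assms
proof (induction J arbitrary: I a rule: finite_induct)
  case empty
  then have "I \<noteq> {}" by auto
  then show ?case by (intro exI[of _ "\<lambda>_. 1"]) auto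
next
  case (insert j J)
  show ?case
  proof (cases "\<forall>i\<in>I. a i j = 0")
    case True
    have "card J < card I" using insert.hyps insert.prems by simp
    from insert.IH[OF \<open>finite I\<close> this, of a] obtain c
      where "\<exists>i\<in>I. c i \<noteq> 0" "\<forall>k\<in>J. (\<Sum>i\<in>I. c i * a i k) = 0" by blast
    with True show ?thesis by (intro exI[of _ c]) auto
  next
    case False
    then obtain p where p: "p \<in> I" "a p j \<noteq> 0" by blast
    \<comment> \<open>Row \<open>p\<close> is the pivot: subtracting its multiples from all rows
      clears column \<open>j\<close>.\<close>
    define b where "b i k = a i k - a i j / a p j * a p k" for i k
    have "card J < card (I - {p})"
      using insert.hyps insert.prems p by simp
    with insert.IH[of "I - {p}" b] insert.prems obtain c
      where c: "\<exists>i\<in>I - {p}. c i \<noteq> 0" "\<forall>k\<in>J. (\<Sum>i\<in>I - {p}. c i * b i k) = 0" by auto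
    \<comment> \<open>The value at \<open>p\<close> is the one that solves equation \<open>j\<close>
      for the pivot unknown; it turns a relation among the reduced rows into one among the original
      rows.\<close>
    define d where "d = c(p := - (\<Sum>i\<in>I - {p}. c i * a i j) / a p j)"
    have "(\<Sum>i\<in>I. d i * a i k) = (\<Sum>i\<in>I - {p}. c i * b i k)" for k
    proof -
      have "(\<Sum>i\<in>I. d i * a i k) = d p * a p k + (\<Sum>i\<in>I - {p}. d i * a i k)"
        by (rule sum.remove) (use insert.prems p in auto)
      also have "(\<Sum>i\<in>I - {p}. d i * a i k) = (\<Sum>i\<in>I - {p}. c i * a i k)"
        by (rule sum.cong) (auto simp: d_def)
      also have "d p * a p k = - (\<Sum>i\<in>I - {p}. c i * (a i j / a p j * a p k))"
        by (simp add: d_def sum_distrib_right sum_divide_distrib mult.assoc)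
      finally show ?thesis
        by (simp add: b_def right_diff_distrib sum_subtractf)
    qed
    moreover have "b i j = 0" for i using p by (simp add: b_def)
    ultimately have "\<forall>k\<in>insert j J. (\<Sum>i\<in>I. d i * a i k) = 0"
      using c(2) by simp
    moreover have "\<exists>i\<in>I. d i \<noteq> 0" using c(1) by (auto simp: d_def)
    ultimately show ?thesis by blast
  qed
qed

definition sign_vector :: "'a set \<Rightarrow> 'a \<Rightarrow> real" where
  "sign_vector F k = (if k \<in> F then 1 else - 1)"

text \<open>Coordinates where \<open>F\<close> and \<open>G\<close> agree contribute 1, the others
  -1, so each element of the symmetric difference costs 2.\<close>

lemma sign_vector_inner:
  assumes "finite A" "F \<subseteq> A" "G \<subseteq> A"
  shows "(\<Sum>k\<in>A. sign_vector F k * sign_vector G k) = real (card A) - 2 * real (card (sym_diff F G))"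
proof -
  have "(\<Sum>k\<in>A. sign_vector F k * sign_vector G k)
      = (\<Sum>k\<in>A. 1 - 2 * (if k \<in> sym_diff F G then 1 else 0))"
    by (rule sum.cong) (auto simp: sign_vector_def)
  also have "\<dots> = real (card A) - 2 * real (card (A \<inter> sym_diff F G))"
    by (simp only: sum_subtractf flip: sum_distrib_left sum.inter_restrict[OF assms(1)]) simp
  also have "A \<inter> sym_diff F G = sym_diff F G" using assms by blast
  finally show ?thesis .
qed

theorem theorem3:
  fixes n lam :: nat and \<F> :: "nat set set"
  assumes "n > 0"
    and "\<F> \<subseteq> Pow {1..n}"
    and "lam > 0"
    and "\<And>F G. F \<in> \<F> \<Longrightarrow> G \<in> \<F> \<Longrightarrow> F \<noteq> G \<Longrightarrow> card (sym_diff F G) = lam"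
    and "real lam \<noteq> (real n + 1) / 2"
  shows "card \<F> \<le> n"
proof (rule ccontr)
  assume "\<not> card \<F> \<le> n"
  \<comment> \<open>Exactly \<open>n + 1\<close> members are kept, since this count makes the
    excluded value of \<open>lam\<close> appear as a root below.\<close>
  then obtain I where I: "I \<subseteq> \<F>" "card I = n + 1" "finite I"
    using obtain_subset_with_card_n[of "n + 1" \<F>] by auto
  obtain c where nonzero: "\<exists>F\<in>I. c F \<noteq> 0"
    and relation: "\<forall>k\<in>{1..n}. (\<Sum>F\<in>I. c F * sign_vector F k) = 0"
    using nontrivial_linear_relation[of "{1..n}" I sign_vector] I by auto
  define S where "S = (\<Sum>F\<in>I. c F)"
  \<comment> \<open>Pairing the relation with the sign vector of \<open>G\<close> gives row
    \<open>G\<close> of the Gram matrix applied to \<open>c\<close>.\<close>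
  have gram: "2 * lam * c G + (real n - 2 * lam) * S = 0" if "G \<in> I" for G
  proof -
    have inner: "(\<Sum>k\<in>{1..n}. sign_vector F k * sign_vector G k)
        = (real n - 2 * lam) + (if F = G then 2 * lam else 0)" if "F \<in> I" for F
      using sign_vector_inner[of "{1..n}" F G] assms(2) assms(4)[of F G] I(1) that \<open>G \<in> I\<close>
      by (cases "F = G") auto
    have "0 = (\<Sum>k\<in>{1..n}. (\<Sum>F\<in>I. c F * sign_vector F k) * sign_vector G k)"
      using relation by simp
    also have "\<dots> = (\<Sum>F\<in>I. c F * (\<Sum>k\<in>{1..n}. sign_vector F k * sign_vector G k))"
      unfolding sum_distrib_left sum_distrib_right
      by (subst sum.swap) (simp add: mult.assoc)
    also have "\<dots> = (\<Sum>F\<in>I. c F * (real n - 2 * lam) + (if F = G then c F * (2 * lam) else 0))"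
      by (intro sum.cong refl, subst inner) (simp_all add: distrib_left)
    also have "\<dots> = S * (real n - 2 * lam) + c G * (2 * lam)"
      using I that by (simp add: sum.distrib S_def sum_distrib_right)
    finally show ?thesis by (simp add: algebra_simps)
  qed
  \<comment> \<open>Adding all \<open>n + 1\<close> rows leaves a single equation in
    \<open>S\<close>.\<close>
  have "0 = (\<Sum>G\<in>I. 2 * lam * c G + (real n - 2 * lam) * S)"
    using gram by simp
  also have "\<dots> = 2 * lam * S + (real n + 1) * ((real n - 2 * lam) * S)"
    using I by (simp add: sum.distrib S_def flip: sum_distrib_left)
  also have "\<dots> = real n * (real n + 1 - 2 * lam) * S"
    by (simp add: algebra_simps)
  \<comment> \<open>Both factors in front of \<open>S\<close> are nonzero, by \<open>n > 0\<close>
    and the condition on \<open>lam\<close>.\<close>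
  finally have "S = 0" using assms(1,5) by auto
  then have "c G = 0" if "G \<in> I" for G using gram[OF that] assms(3) by simp
  with nonzero show False by blast
qed

end
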